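(* Let $0\le\alpha\le1$. The radius of convexity of the class $\mathcal{BS}(\alpha)$ is $r_\alpha=\min\{r'_\alpha,r''_\alpha\}$, where $r'_\alpha$ and $r''_\alpha$ are the roots lying in $(0,1]$ of the equations $$l_\alpha(r):=\alpha^2r^4+\alpha r^3+(1-2\alpha)r^2-3r+1=0\qquad\text{and}\qquad m_\alpha(r):=1-r-\alpha r^2=0,$$ respectively.
   Context: $\mathbb{D}=\{z\in\mathbb{C}:|z|<1\}$. $\mathcal{A}$ is the class of analytic functions $f$ in $\mathbb{D}$ with $f(0)=0$, $f'(0)=1$. For analytic $f,g$ in $\mathbb{D}$, $f$ is subordinate to $g$, written $f\prec g$, if there is an analytic $\omega:\mathbb{D}\to\mathbb{D}$ with $\omega(0)=0$ and $f(z)=g(\omega(z))$ for all $z\in\mathbb{D}$. For $0\le\alpha\le1$ let $F_\alpha(z)=\dfrac{z}{1-\alpha z^2}$, and let $\mathcal{BS}(\alpha)$ be the class of $f\in\mathcal{A}$ such that $\dfrac{zf'(z)}{f(z)}-1\prec F_\alpha(z)$ (in particular $zf'(z)/f(z)$ is analytic in $\mathbb{D}$, with value $1$ at $z=0$). The radius of convexity of a class $\mathcal{F}\subset\mathcal{A}$ is the largest number $s\in[0,1]$ such that $\operatorname{Re}\left(1+\dfrac{zf''(z)}{f'(z)}\right)>0$ for all $|z|<s$ and all $f\in\mathcal{F}$. *)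

theory Defs
  imports "HOL-Complex_Analysis.Complex_Analysis"
begin

abbreviation unit_disc :: "complex set" where
  "unit_disc \<equiv> ball 0 1"

definition class_A :: "(complex \<Rightarrow> complex) set" where
  "class_A = {f. f holomorphic_on unit_disc \<and> f 0 = 0 \<and> deriv f 0 = 1}"

definition subordinate :: "(complex \<Rightarrow> complex) \<Rightarrow> (complex \<Rightarrow> complex) \<Rightarrow> bool" where
  "subordinate f g \<longleftrightarrow>
     f holomorphic_on unit_disc \<and> g holomorphic_on unit_disc \<and>
     (\<exists>\<omega>. \<omega> holomorphic_on unit_disc \<and> \<omega> ` unit_disc \<subseteq> unit_disc \<and> \<omega> 0 = 0 \<and>
          (\<forall>z\<in>unit_disc. f z = g (\<omega> z)))"

definition booth :: "real \<Rightarrow> complex \<Rightarrow> complex" where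
  "booth \<alpha> z = z / (1 - of_real \<alpha> * z\<^sup>2)"

text \<open>
  The quotient \<open>z f'(z) / f(z)\<close> with its removable singularity at \<open>0\<close> filled in
  (the value is \<open>1\<close> for \<open>f\<close> in \<open>class_A\<close>).  A further zero of \<open>f\<close> in the disc would be a pole
  of the quotient; the convention \<open>x / 0 = 0\<close> does not hide it, since
  the quotient is unbounded nearby and hence not holomorphic on the disc.
\<close>
definition log_deriv_quot :: "(complex \<Rightarrow> complex) \<Rightarrow> complex \<Rightarrow> complex" where
  "log_deriv_quot f z = (if z = 0 then 1 else z * deriv f z / f z)"

definition class_BS :: "real \<Rightarrow> (complex \<Rightarrow> complex) set" where
  "class_BS \<alpha> = {f \<in> class_A. subordinate (\<lambda>z. log_deriv_quot f z - 1) (booth \<alpha>)}"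

text \<open>
  The condition \<open>deriv f z \<noteq> 0\<close> says that the quotient \<open>f''/f'\<close> is defined at \<open>z\<close>.
\<close>
definition convex_within :: "(complex \<Rightarrow> complex) set \<Rightarrow> real \<Rightarrow> bool" where
  "convex_within \<F> s \<longleftrightarrow>
     (\<forall>f\<in>\<F>. \<forall>z. norm z < s \<longrightarrow>
        deriv f z \<noteq> 0 \<and> Re (1 + z * deriv (deriv f) z / deriv f z) > 0)"

definition is_radius_of_convexity :: "(complex \<Rightarrow> complex) set \<Rightarrow> real \<Rightarrow> bool" where
  "is_radius_of_convexity \<F> r \<longleftrightarrow>
     r \<in> {0..1} \<and> convex_within \<F> r \<and> (\<forall>s\<in>{0..1}. convex_within \<F> s \<longrightarrow> s \<le> r)"

definition l_poly :: "real \<Rightarrow> real \<Rightarrow> real" where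
  "l_poly \<alpha> r = \<alpha>\<^sup>2 * r ^ 4 + \<alpha> * r ^ 3 + (1 - 2 * \<alpha>) * r\<^sup>2 - 3 * r + 1"

definition m_poly :: "real \<Rightarrow> real \<Rightarrow> real" where
  "m_poly \<alpha> r = 1 - r - \<alpha> * r\<^sup>2"

end

theory Submission
  imports Defs
begin

text \<open>
  Write \<open>z f'(z) / f(z) = 1 + F\<^sub>\<alpha>(\<omega>(z))\<close> with \<open>\<omega>\<close> a Schwarz function.  Logarithmic differentiation expresses
  \<open>1 + z f''(z) / f'(z)\<close> through \<open>w = \<omega>(z)\<close> and \<open>\<omega>'(z)\<close>, and the triangle inequality
  together with the Schwarz--Pick estimate for \<open>\<omega>'(z)\<close> bounds its real part from below by a quantity
  that decreases in \<open>\<bar>w\<bar>\<close>.  Since \<open>\<bar>w\<bar> \<le> \<bar>z\<bar> = r\<close>, the worst case is \<open>\<bar>w\<bar> = r\<close>, where the bound equals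
  \<open>l\<^sub>\<alpha>(r) / ((1 - \<alpha> r\<^sup>2) m\<^sub>\<alpha>(r))\<close>.  It is attained for \<open>\<omega>(z) = z\<close> at \<open>z = -r\<close>.
  As \<open>l\<^sub>\<alpha>(r) = m\<^sub>\<alpha>(r)\<^sup>2 - r (1 + \<alpha> r\<^sup>2)\<close>, the root of \<open>l\<^sub>\<alpha>\<close> is always the smaller one.
\<close>

section \<open>Roots and monotonicity of the two polynomials\<close>

text \<open>Monotonicity and sign of \<open>l_poly\<close> are both read off this form: a square
  minus a term that increases for r \<ge> 0.\<close>

lemma l_poly_eq: "l_poly \<alpha> r = (m_poly \<alpha> r)\<^sup>2 - r * (1 + \<alpha> * r\<^sup>2)"
  unfolding l_poly_def m_poly_def by algebra

lemma m_poly_strict_antimono: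
  assumes "0 \<le> \<alpha>" "0 \<le> r" "r < s"
  shows "m_poly \<alpha> s < m_poly \<alpha> r"
proof -
  have "\<alpha> * r\<^sup>2 \<le> \<alpha> * s\<^sup>2"
    using assms by (intro mult_left_mono power_mono) auto
  then show ?thesis
    using assms by (simp add: m_poly_def)
qed

text \<open>As \<open>m_poly\<close> decreases and is still nonnegative at s, it is nonnegative at r
  too, so squaring preserves the order.\<close>

lemma l_poly_strict_antimono:
  assumes "0 \<le> \<alpha>" "0 \<le> r" "r < s" "0 \<le> m_poly \<alpha> s"
  shows "l_poly \<alpha> s < l_poly \<alpha> r"
proof -
  have "(m_poly \<alpha> s)\<^sup>2 \<le> (m_poly \<alpha> r)\<^sup>2"
    using m_poly_strict_antimono[OF assms(1-3)] assms(4) by (intro power_mono) auto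
  moreover have "r * (1 + \<alpha> * r\<^sup>2) < s * (1 + \<alpha> * s\<^sup>2)"
    using assms by (intro mult_less_le_imp_less mult_left_mono add_left_mono power_mono)
      (auto intro: add_pos_nonneg)
  ultimately show ?thesis
    by (simp add: l_poly_eq)
qed

text \<open>Here \<open>- m_poly \<alpha> r\<close> is at most r because \<alpha> r^2 \<le> 1, so
  the square is at most r^2 \<le> r and at most -\<alpha> r^3 remains. For \<alpha> = 0 this is not
  strict, but then r = 1, where the value is -1. Hence every root of \<open>l_poly\<close> in (0,1]
  lies where \<open>m_poly\<close> is positive.\<close>

lemma l_poly_neg:
  assumes "0 \<le> \<alpha>" "\<alpha> \<le> 1" "0 < r" "r \<le> 1" "m_poly \<alpha> r \<le> 0"
  shows "l_poly \<alpha> r < 0"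
proof -
  have *: "\<alpha> * r\<^sup>2 \<le> 1"
    using assms by (simp add: mult_le_one power_le_one)
  have "(m_poly \<alpha> r)\<^sup>2 \<le> r\<^sup>2"
    using assms(5) * by (intro abs_le_square_iff[THEN iffD1]) (auto simp: m_poly_def)
  also have "r\<^sup>2 \<le> r"
    using assms by (simp add: power2_eq_square mult_left_le)
  finally have le: "(m_poly \<alpha> r)\<^sup>2 \<le> r" .
  show ?thesis
  proof (cases "\<alpha> = 0")
    case True
    then have "r = 1" using assms by (simp add: m_poly_def)
    then show ?thesis using True by (simp add: l_poly_def)
  next
    case False
    then have "0 < r * (\<alpha> * r\<^sup>2)" using assms by simp
    then show ?thesis using le by (simp add: l_poly_eq distrib_left)
  qed
qed

lemma poly_roots:
  assumes "0 \<le> \<alpha>" "\<alpha> \<le> 1"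
  obtains r' r'' where
    "{r \<in> {0<..1}. l_poly \<alpha> r = 0} = {r'}" "{r \<in> {0<..1}. m_poly \<alpha> r = 0} = {r''}" "r' < r''"
proof -
  have "\<exists>r\<ge>0. r \<le> 1 \<and> m_poly \<alpha> r = 0"
    by (rule IVT2') (use assms in \<open>auto simp: m_poly_def intro!: continuous_intros\<close>)
  then obtain b where b: "0 \<le> b" "b \<le> 1" "m_poly \<alpha> b = 0" by blast
  have "b > 0" using b by (cases "b = 0") (auto simp: m_poly_def)
  have lb: "l_poly \<alpha> b < 0" using l_poly_neg assms b \<open>b > 0\<close> by simp
  \<comment> \<open>Searching only up to the root b of \<open>m_poly\<close>, where
    \<open>l_poly\<close> is already negative, also yields the order of the two roots.\<close>
  have "\<exists>r\<ge>0. r \<le> b \<and> l_poly \<alpha> r = 0"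
    by (rule IVT2') (use lb b in \<open>auto simp: l_poly_def intro!: continuous_intros\<close>)
  then obtain a where a: "0 \<le> a" "a \<le> b" "l_poly \<alpha> a = 0" by blast
  have "a > 0" using a by (cases "a = 0") (auto simp: l_poly_def)
  have "a < b" using a lb by (cases "a = b") auto
  have m_uniq: "r = b" if "0 < r" "m_poly \<alpha> r = 0" for r
    using m_poly_strict_antimono[of \<alpha> r b] m_poly_strict_antimono[of \<alpha> b r] that b assms
    by (cases r b rule: linorder_cases) auto
  have l_uniq: "r = a" if "0 < r" "r \<le> 1" "l_poly \<alpha> r = 0" for r
  proof -
    have "m_poly \<alpha> r > 0" "m_poly \<alpha> a > 0"
      using l_poly_neg[of \<alpha> r] l_poly_neg[of \<alpha> a] that a b \<open>a > 0\<close> assms by force+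
    then show ?thesis
      using l_poly_strict_antimono[of \<alpha> r a] l_poly_strict_antimono[of \<alpha> a r] that a assms
      by (cases r a rule: linorder_cases) auto
  qed
  show thesis
  proof
    show "{r \<in> {0<..1}. l_poly \<alpha> r = 0} = {a}"
      using a b \<open>a > 0\<close> by (auto dest: l_uniq)
    show "{r \<in> {0<..1}. m_poly \<alpha> r = 0} = {b}"
      using b \<open>b > 0\<close> by (auto dest: m_uniq)
  qed fact
qed

section \<open>The Schwarz-Pick inequality\<close>

text \<open>Disc automorphisms S, taking 0 to a, and T, taking \<omega>(a) to 0, turn \<omega> into
  a self-map h of the disc fixing 0. The Schwarz lemma bounds h'(0), and the chain rule converts
  this into a bound for \<omega>'(a).\<close>

lemma Schwarz_Pick:
  assumes hol: "\<omega> holomorphic_on ball 0 1" and im: "\<omega> ` ball 0 1 \<subseteq> ball 0 1" and a: "norm a < 1"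
  shows "norm (deriv \<omega> a) \<le> (1 - (norm (\<omega> a))\<^sup>2) / (1 - (norm a)\<^sup>2)"
proof -
  define b where "b = \<omega> a"
  have b: "norm b < 1" using im a by (auto simp: b_def image_subset_iff)
  have a2: "(norm a)\<^sup>2 < 1" and b2: "(norm b)\<^sup>2 < 1"
    using a b by (auto simp: power_less_one_iff)
  define S where "S = Moebius_function 0 (-a)"
  define T where "T = Moebius_function 0 b"
  have S0: "S 0 = a" by (simp add: S_def Moebius_function_of_zero)
  have S_im: "S ` ball 0 1 \<subseteq> ball 0 1" and S_hol: "S holomorphic_on ball 0 1"
    using a by (auto simp: S_def Moebius_function_norm_lt_1 Moebius_function_holomorphic)
  have T_im: "T ` ball 0 1 \<subseteq> ball 0 1" and T_hol: "T holomorphic_on ball 0 1"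
    using b by (auto simp: T_def Moebius_function_norm_lt_1 Moebius_function_holomorphic)
  define h where "h = T \<circ> (\<omega> \<circ> S)"
  have "h holomorphic_on ball 0 1"
    unfolding h_def
    by (intro holomorphic_on_compose_gen[OF _ T_hol] holomorphic_on_compose_gen[OF S_hol hol])
       (use S_im im in auto)
  moreover have "h 0 = 0"
    by (simp add: h_def S0 T_def Moebius_function_eq_zero flip: b_def)
  moreover have "norm (h z) < 1" if "norm z < 1" for z
    using that S_im im T_im unfolding h_def by (auto simp: image_subset_iff)
  ultimately have h1: "norm (deriv h 0) \<le> 1"
    using Schwarz_Lemma(2)[of h 0] by simp
  have "(S has_field_derivative 1 - a * cnj a) (at 0)"
    unfolding S_def Moebius_function_def
    by (rule derivative_eq_intros refl | simp)+
  moreover have "(\<omega> has_field_derivative deriv \<omega> a) (at a)"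
    using hol a by (auto intro: holomorphic_derivI)
  moreover have nz: "1 - cnj b * b \<noteq> 0"
    using b2 by (metis complex_norm_square eq_iff_diff_eq_0 less_irrefl mult.commute of_real_eq_1_iff)
  then have "(T has_field_derivative 1 / (1 - cnj b * b)) (at b)"
    unfolding T_def Moebius_function_def
    by - (rule derivative_eq_intros refl nz | simp)+
  ultimately have "(h has_field_derivative 1 / (1 - cnj b * b) * (deriv \<omega> a * (1 - a * cnj a))) (at 0)"
    unfolding h_def by (intro DERIV_chain) (auto simp: S0 b_def)
  then have "deriv h 0 = 1 / (1 - cnj b * b) * (deriv \<omega> a * (1 - a * cnj a))"
    by (rule DERIV_imp_deriv)
  moreover have "norm (1 - cnj b * b) = 1 - (norm b)\<^sup>2"
  proof -
    have "1 - cnj b * b = of_real (1 - (norm b)\<^sup>2)" using complex_norm_square[of b] by (simp add: mult.commute)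
    then show ?thesis using b2 by (simp only: norm_of_real)
  qed
  moreover have "norm (1 - a * cnj a) = 1 - (norm a)\<^sup>2"
  proof -
    have "1 - a * cnj a = of_real (1 - (norm a)\<^sup>2)" using complex_norm_square[of a] by simp
    then show ?thesis using a2 by (simp only: norm_of_real)
  qed
  ultimately have "norm (deriv \<omega> a) * (1 - (norm a)\<^sup>2) / (1 - (norm b)\<^sup>2) \<le> 1"
    using h1 by (simp add: norm_mult norm_divide)
  then show ?thesis
    using a2 b2 by (simp add: field_simps b_def)
qed

section \<open>Logarithmic differentiation\<close>

lemma log_deriv_quot_imp_nonzero:
  assumes f: "f \<in> class_A" and hol: "log_deriv_quot f holomorphic_on unit_disc"
    and a: "norm a < 1" "a \<noteq> 0"
  shows "f a \<noteq> 0"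
  \<comment> \<open>At a zero of order \<open>n\<close>, comparing leading coefficients in \<open>z f' = P f\<close> with \<open>P\<close> continuous gives \<open>n a = 0\<close>.\<close>
proof
  assume "f a = 0"
  have f_hol: "f holomorphic_on unit_disc" and f0: "f 0 = 0" "deriv f 0 = 1"
    using f by (auto simp: class_A_def)
  \<comment> \<open>Nonconstancy, forced by f'(0) = 1, gives the zero at a a finite order.\<close>
  have nonconst: "\<not> f constant_on unit_disc"
  proof
    assume "f constant_on unit_disc"
    then obtain c where "\<And>z. z \<in> unit_disc \<Longrightarrow> f z = c"
      unfolding constant_on_def by blast
    then have "(f has_field_derivative 0) (at 0)"
      using has_field_derivative_transform_within_open[of "\<lambda>_. c" 0 0 unit_disc f] by simp
    then show False using f0 DERIV_imp_deriv by fastforce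
  qed
  have "a \<in> unit_disc" using a by simp
  then obtain g r n where n: "0 < n" and r: "0 < r" "ball a r \<subseteq> unit_disc"
    and g: "g holomorphic_on ball a r" "\<And>w. w \<in> ball a r \<Longrightarrow> f w = (w - a) ^ n * g w"
      "\<And>w. w \<in> ball a r \<Longrightarrow> g w \<noteq> 0"
    using holomorphic_factor_zero_nonconstant[OF f_hol open_ball connected_ball _ \<open>f a = 0\<close> nonconst]
    by metis
  \<comment> \<open>The common factor (w - a)^(n-1) is cancelled, so that both sides are continuous
    at a.\<close>
  have eq: "log_deriv_quot f w * (w - a) * g w = w * (of_nat n * g w + (w - a) * deriv g w)"
    if w: "w \<in> ball a r" "w \<noteq> a" "w \<noteq> 0" for w
  proof -
    have "((\<lambda>w. (w - a) ^ n * g w) has_field_derivative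
        of_nat n * (w - a) ^ (n - 1) * g w + (w - a) ^ n * deriv g w) (at w)"
      using holomorphic_derivI[OF g(1) open_ball w(1)]
      by (auto intro!: derivative_eq_intros)
    then have "(f has_field_derivative
        of_nat n * (w - a) ^ (n - 1) * g w + (w - a) ^ n * deriv g w) (at w)"
      by (rule has_field_derivative_transform_within_open[where S = "ball a r"])
        (use g(2) w in auto)
    then have D: "deriv f w = of_nat n * (w - a) ^ (n - 1) * g w + (w - a) ^ n * deriv g w"
      by (rule DERIV_imp_deriv)
    have P: "(w - a) ^ n = (w - a) ^ (n - 1) * (w - a)"
      using n by (metis power_minus_mult)
    show ?thesis
      using w g(3)[OF w(1)] unfolding log_deriv_quot_def D g(2)[OF w(1)] P
      by (simp add: field_simps)
  qed
  have "isCont (log_deriv_quot f) a"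
    using holomorphic_on_imp_continuous_on[OF hol] a by (simp add: continuous_on_eq_continuous_at)
  moreover have "isCont g a"
    using holomorphic_on_imp_continuous_on[OF g(1)] r by (simp add: continuous_on_eq_continuous_at)
  moreover have "isCont (deriv g) a"
    using holomorphic_on_imp_continuous_on[OF holomorphic_deriv[OF g(1)]] r
    by (simp add: continuous_on_eq_continuous_at)
  ultimately have lim1: "(\<lambda>w. log_deriv_quot f w * (w - a) * g w) \<midarrow>a\<rightarrow> log_deriv_quot f a * (a - a) * g a"
    and lim2: "(\<lambda>w. w * (of_nat n * g w + (w - a) * deriv g w)) \<midarrow>a\<rightarrow> a * (of_nat n * g a + (a - a) * deriv g a)"
    unfolding isCont_def by - (intro tendsto_intros; assumption)+
  \<comment> \<open>The identity is available only off a and 0. As a \<noteq> 0, it holds throughout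
    a punctured neighbourhood of a, so the limits at a coincide: 0 on the left, n a g(a) on the
    right.\<close>
  have "\<forall>\<^sub>F w in at a. w \<in> ball a r - {0} \<and> w \<noteq> a"
    using a r by (intro eventually_conj eventually_at_in_open' eventually_neq_at_within) auto
  then have "\<forall>\<^sub>F w in at a. log_deriv_quot f w * (w - a) * g w = w * (of_nat n * g w + (w - a) * deriv g w)"
    by eventually_elim (use eq in auto)
  then have "log_deriv_quot f a * (a - a) * g a = a * (of_nat n * g a + (a - a) * deriv g a)"
    by (rule LIM_unique[OF Lim_transform_eventually[OF lim1] lim2])
  then show False
    using n a r g(3)[of a] by auto
qed

text \<open>With P the filled-in quotient, differentiating z f' = P f and dividing by f' avoids any
  choice of logarithm; then f/f' = z/P. Since P and f do not vanish at z, neither does f'.\<close>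

lemma convexity_quotient_eq:
  assumes f: "f \<in> class_A" and hol: "log_deriv_quot f holomorphic_on unit_disc"
    and z: "norm z < 1" "z \<noteq> 0" and nz: "log_deriv_quot f z \<noteq> 0"
  shows "deriv f z \<noteq> 0"
    and "1 + z * deriv (deriv f) z / deriv f z =
      log_deriv_quot f z + z * deriv (log_deriv_quot f) z / log_deriv_quot f z"
proof -
  let ?P = "log_deriv_quot f"
  have f_hol: "f holomorphic_on unit_disc"
    using f by (auto simp: class_A_def)
  have eq: "w * deriv f w = ?P w * f w" if "norm w < 1" "w \<noteq> 0" for w
    using log_deriv_quot_imp_nonzero[OF f hol that] that by (simp add: log_deriv_quot_def)
  have fz: "f z \<noteq> 0" by (rule log_deriv_quot_imp_nonzero[OF f hol z])
  show *: "deriv f z \<noteq> 0"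
    using eq[OF z] nz fz by auto
  have "((\<lambda>w. ?P w * f w) has_field_derivative deriv ?P z * f z + deriv f z * ?P z) (at z)"
    using holomorphic_derivI[OF hol, of z] holomorphic_derivI[OF f_hol, of z] z
    by (intro DERIV_mult) auto
  then have "((\<lambda>w. w * deriv f w) has_field_derivative deriv ?P z * f z + deriv f z * ?P z) (at z)"
    by (rule has_field_derivative_transform_within_open[where S = "unit_disc - {0}"])
      (use z eq in auto)
  moreover have "((\<lambda>w. w * deriv f w) has_field_derivative 1 * deriv f z + deriv (deriv f) z * z) (at z)"
    using holomorphic_derivI[OF holomorphic_deriv[OF f_hol], of z] z
    by (intro DERIV_mult) auto
  ultimately have "deriv f z + z * deriv (deriv f) z = deriv ?P z * f z + deriv f z * ?P z"
    by (metis DERIV_unique mult_1 mult.commute)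
  then have "1 + z * deriv (deriv f) z / deriv f z = ?P z + deriv ?P z * (f z / deriv f z)"
    using * by (simp add: field_simps)
  also have "f z / deriv f z = z / ?P z"
    using eq[OF z] * nz by (simp add: field_simps)
  finally show "1 + z * deriv (deriv f) z / deriv f z = ?P z + z * deriv ?P z / ?P z"
    by (simp add: mult.commute)
qed

section \<open>The Booth function and the convexity expression\<close>

lemma booth_denom_norm_ge:
  fixes w :: complex
  assumes "0 \<le> \<alpha>"
  shows "1 - \<alpha> * (norm w)\<^sup>2 \<le> norm (1 - of_real \<alpha> * w\<^sup>2)"
  using norm_triangle_ineq2[of 1 "of_real \<alpha> * w\<^sup>2"] assms
  by (simp add: norm_mult norm_power)

lemma booth_denom_pos:
  fixes \<alpha> \<rho> :: real
  assumes "0 \<le> \<alpha>" "\<alpha> \<le> 1" "0 \<le> \<rho>" "\<rho> < 1"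
  shows "0 < 1 - \<alpha> * \<rho>\<^sup>2"
proof -
  have "\<alpha> * \<rho>\<^sup>2 \<le> 1 * \<rho>\<^sup>2" using assms by (intro mult_right_mono) auto
  also have "\<dots> < 1" using assms by (simp add: power_less_one_iff)
  finally show ?thesis by simp
qed

lemma booth_denom_nonzero:
  fixes w :: complex
  assumes "0 \<le> \<alpha>" "\<alpha> \<le> 1" "norm w < 1"
  shows "1 - of_real \<alpha> * w\<^sup>2 \<noteq> 0"
  using booth_denom_norm_ge[of \<alpha> w] booth_denom_pos[of \<alpha> "norm w"] assms by force

lemma has_field_derivative_booth:
  assumes "1 - of_real \<alpha> * w\<^sup>2 \<noteq> 0"
  shows "(booth \<alpha> has_field_derivative
    (1 + of_real \<alpha> * w\<^sup>2) / (1 - of_real \<alpha> * w\<^sup>2)\<^sup>2) (at w)"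
  unfolding booth_def
  by (rule derivative_eq_intros refl assms)+ (simp add: power2_eq_square algebra_simps)

lemma booth_holomorphic:
  assumes "0 \<le> \<alpha>" "\<alpha> \<le> 1"
  shows "booth \<alpha> holomorphic_on unit_disc"
  unfolding booth_def using booth_denom_nonzero[OF assms]
  by (intro holomorphic_intros) auto

text \<open>The quotient P equals (1 + \<omega> - \<alpha> \<omega>^2) / (1 - \<alpha> \<omega>^2),
  so the last hypothesis says that P(z) \<noteq> 0, and one factor of the squared denominator of P'
  cancels in z P'/P.\<close>

lemma BS_convexity_quotient_eq:
  assumes \<alpha>: "0 \<le> \<alpha>" "\<alpha> \<le> 1" and f: "f \<in> class_A"
    and hol: "\<omega> holomorphic_on unit_disc" and im: "\<omega> ` unit_disc \<subseteq> unit_disc"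
    and eq: "\<forall>z\<in>unit_disc. log_deriv_quot f z = 1 + booth \<alpha> (\<omega> z)"
    and z: "norm z < 1" "z \<noteq> 0" and nz: "1 + \<omega> z - of_real \<alpha> * (\<omega> z)\<^sup>2 \<noteq> 0"
  shows "deriv f z \<noteq> 0"
    and "1 + z * deriv (deriv f) z / deriv f z = 1 + booth \<alpha> (\<omega> z) +
      z * deriv \<omega> z * (1 + of_real \<alpha> * (\<omega> z)\<^sup>2) /
        ((1 - of_real \<alpha> * (\<omega> z)\<^sup>2) * (1 + \<omega> z - of_real \<alpha> * (\<omega> z)\<^sup>2))"
proof -
  let ?P = "log_deriv_quot f"
  have "(booth \<alpha> \<circ> \<omega>) holomorphic_on unit_disc"
    using holomorphic_on_compose_gen[OF hol booth_holomorphic[OF \<alpha>] im] .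
  then have "(\<lambda>z. 1 + booth \<alpha> (\<omega> z)) holomorphic_on unit_disc"
    by (auto intro!: holomorphic_intros simp: o_def)
  then have P_hol: "?P holomorphic_on unit_disc"
    by (rule holomorphic_transform) (simp add: eq)
  have d: "1 - of_real \<alpha> * (\<omega> z)\<^sup>2 \<noteq> 0"
    using booth_denom_nonzero[OF \<alpha>, of "\<omega> z"] im z by (auto simp: image_subset_iff)
  have Pz: "?P z = (1 + \<omega> z - of_real \<alpha> * (\<omega> z)\<^sup>2) / (1 - of_real \<alpha> * (\<omega> z)\<^sup>2)"
    using d by (simp add: eq z booth_def field_simps)
  then have P_nz: "?P z \<noteq> 0" using d nz by simp
  have "((\<lambda>z. 1 + booth \<alpha> (\<omega> z)) has_field_derivative
      (1 + of_real \<alpha> * (\<omega> z)\<^sup>2) / (1 - of_real \<alpha> * (\<omega> z)\<^sup>2)\<^sup>2 * deriv \<omega> z) (at z)"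
    using DERIV_chain2[OF has_field_derivative_booth[OF d] holomorphic_derivI[OF hol]] z
    by (auto intro!: derivative_eq_intros)
  then have "(?P has_field_derivative
      (1 + of_real \<alpha> * (\<omega> z)\<^sup>2) / (1 - of_real \<alpha> * (\<omega> z)\<^sup>2)\<^sup>2 * deriv \<omega> z) (at z)"
    by (rule has_field_derivative_transform_within_open[where S = unit_disc])
      (use eq z in auto)
  then have dP: "deriv ?P z =
      (1 + of_real \<alpha> * (\<omega> z)\<^sup>2) / (1 - of_real \<alpha> * (\<omega> z)\<^sup>2)\<^sup>2 * deriv \<omega> z"
    by (rule DERIV_imp_deriv)
  note * = convexity_quotient_eq[OF f P_hol z P_nz]
  show "deriv f z \<noteq> 0" by (rule *(1))
  have "z * deriv ?P z / ?P z = z * deriv \<omega> z * (1 + of_real \<alpha> * (\<omega> z)\<^sup>2) /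
        ((1 - of_real \<alpha> * (\<omega> z)\<^sup>2) * (1 + \<omega> z - of_real \<alpha> * (\<omega> z)\<^sup>2))"
    unfolding dP Pz using d nz by (simp add: divide_simps) (simp add: power2_eq_square)
  then show "1 + z * deriv (deriv f) z / deriv f z = 1 + booth \<alpha> (\<omega> z) +
      z * deriv \<omega> z * (1 + of_real \<alpha> * (\<omega> z)\<^sup>2) /
        ((1 - of_real \<alpha> * (\<omega> z)\<^sup>2) * (1 + \<omega> z - of_real \<alpha> * (\<omega> z)\<^sup>2))"
    using *(2) eq z by simp
qed

section \<open>The lower bound\<close>

text \<open>The first two terms combine to
  \<open>m_poly \<alpha> r / (1 - \<alpha> * r\<^sup>2)\<close>; over the common denominator the
  numerator is then the one in \<open>l_poly_eq\<close>. The same value serves as lower bound and as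
  extremal value.\<close>

lemma l_poly_quotient:
  assumes "1 - \<alpha> * r\<^sup>2 \<noteq> 0" "m_poly \<alpha> r \<noteq> 0"
  shows "1 - r / (1 - \<alpha> * r\<^sup>2) - r * (1 + \<alpha> * r\<^sup>2) / ((1 - \<alpha> * r\<^sup>2) * m_poly \<alpha> r) =
    l_poly \<alpha> r / ((1 - \<alpha> * r\<^sup>2) * m_poly \<alpha> r)"
proof -
  have "1 - r / (1 - \<alpha> * r\<^sup>2) = (m_poly \<alpha> r)\<^sup>2 / ((1 - \<alpha> * r\<^sup>2) * m_poly \<alpha> r)"
    using assms by (simp add: power2_eq_square[of "m_poly \<alpha> r"]) (simp add: divide_simps m_poly_def)
  then show ?thesis
    by (simp only: l_poly_eq diff_divide_distrib)
qed

text \<open>The numbers w and v stand for \<omega>(z) and \<omega>'(z); only the Schwarz and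
  Schwarz-Pick inequalities between them and z enter. Each term is estimated by its modulus and then
  compared with the case |w| = |z|.\<close>

lemma BS_convexity_bound:
  assumes \<alpha>: "0 \<le> \<alpha>" "\<alpha> \<le> 1" and w: "norm w \<le> norm z" and z: "norm z < 1"
    and v: "norm v \<le> (1 - (norm w)\<^sup>2) / (1 - (norm z)\<^sup>2)"
    and m: "0 < m_poly \<alpha> (norm z)"
  shows "1 + w - of_real \<alpha> * w\<^sup>2 \<noteq> 0"
    and "l_poly \<alpha> (norm z) / ((1 - \<alpha> * (norm z)\<^sup>2) * m_poly \<alpha> (norm z)) \<le>
      Re (1 + booth \<alpha> w + z * v * (1 + of_real \<alpha> * w\<^sup>2) /
        ((1 - of_real \<alpha> * w\<^sup>2) * (1 + w - of_real \<alpha> * w\<^sup>2)))"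
proof -
  define r \<rho> where "r = norm z" and "\<rho> = norm w"
  have r: "0 \<le> \<rho>" "\<rho> \<le> r" "r < 1" using w z by (auto simp: r_def \<rho>_def)
  have sq: "\<alpha> * \<rho>\<^sup>2 \<le> \<alpha> * r\<^sup>2"
    using r \<alpha> by (intro mult_left_mono power_mono) auto
  have r2: "0 < 1 - r\<^sup>2" using r by (simp add: power_less_one_iff)
  have dr: "0 < 1 - \<alpha> * r\<^sup>2" using booth_denom_pos \<alpha> r by simp
  have m\<rho>: "0 < m_poly \<alpha> \<rho>"
    using m sq r unfolding m_poly_def r_def[symmetric] by linarith
  have B: "1 - \<alpha> * r\<^sup>2 \<le> norm (1 - of_real \<alpha> * w\<^sup>2)"
    using booth_denom_norm_ge[OF \<alpha>(1), of w] sq by (simp add: \<rho>_def)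
  have C: "m_poly \<alpha> \<rho> \<le> norm (1 + w - of_real \<alpha> * w\<^sup>2)"
  proof -
    have "norm (1::complex) \<le> norm (1 + w - of_real \<alpha> * w\<^sup>2) + norm (of_real \<alpha> * w\<^sup>2 - w)"
      using norm_triangle_ineq[of "1 + w - of_real \<alpha> * w\<^sup>2" "of_real \<alpha> * w\<^sup>2 - w"] by simp
    moreover have "norm (of_real \<alpha> * w\<^sup>2 - w) \<le> \<alpha> * \<rho>\<^sup>2 + \<rho>"
      using norm_triangle_ineq4[of "of_real \<alpha> * w\<^sup>2" w] \<alpha> by (simp add: norm_mult norm_power \<rho>_def)
    ultimately show ?thesis by (simp add: m_poly_def)
  qed
  then show "1 + w - of_real \<alpha> * w\<^sup>2 \<noteq> 0" using m\<rho> by force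
  have N: "norm (1 + of_real \<alpha> * w\<^sup>2) \<le> 1 + \<alpha> * r\<^sup>2"
    using norm_triangle_ineq[of 1 "of_real \<alpha> * w\<^sup>2"] sq \<alpha>
    by (simp add: norm_mult norm_power \<rho>_def)
  have "norm (booth \<alpha> w) \<le> r / (1 - \<alpha> * r\<^sup>2)"
    unfolding booth_def norm_divide using w B dr r by (intro frac_le) (auto simp: r_def)
  moreover
  let ?T = "z * v * (1 + of_real \<alpha> * w\<^sup>2) / ((1 - of_real \<alpha> * w\<^sup>2) * (1 + w - of_real \<alpha> * w\<^sup>2))"
  have "norm ?T \<le> r * (1 + \<alpha> * r\<^sup>2) / ((1 - \<alpha> * r\<^sup>2) * m_poly \<alpha> r)"
  proof -
    \<comment> \<open>This shows that \<open>(1 - \<rho>\<^sup>2) / m_poly \<alpha> \<rho>\<close>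
      is largest at \<rho> = r; the difference vanishes there, whence the factor r - \<rho>. The
      bounds for v and for 1 + w - \<alpha> w^2 stay together, since separate worst cases would lose
      a factor 1/(1 - r^2).\<close>
    have "(1 - r\<^sup>2) * m_poly \<alpha> \<rho> - (1 - \<rho>\<^sup>2) * m_poly \<alpha> r =
        (r - \<rho>) * ((1 - r) * (1 - \<rho>) + \<alpha> * (r + \<rho>))"
      unfolding m_poly_def by algebra
    also have "\<dots> \<ge> 0"
      using r \<alpha> by (intro mult_nonneg_nonneg add_nonneg_nonneg) auto
    finally have cross: "(1 - \<rho>\<^sup>2) * m_poly \<alpha> r \<le> (1 - r\<^sup>2) * m_poly \<alpha> \<rho>" by simp
    have "norm v / norm (1 + w - of_real \<alpha> * w\<^sup>2) \<le> (1 - \<rho>\<^sup>2) / (1 - r\<^sup>2) / m_poly \<alpha> \<rho>"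
      using v C m\<rho> r r2 by (intro frac_le divide_nonneg_pos) (auto simp: r_def \<rho>_def power_le_one)
    also have "\<dots> \<le> 1 / m_poly \<alpha> r"
      using cross m m\<rho> r2 by (simp add: field_simps r_def)
    finally have V: "norm v / norm (1 + w - of_real \<alpha> * w\<^sup>2) \<le> 1 / m_poly \<alpha> r" .
    have "norm (1 + of_real \<alpha> * w\<^sup>2) / norm (1 - of_real \<alpha> * w\<^sup>2) \<le> (1 + \<alpha> * r\<^sup>2) / (1 - \<alpha> * r\<^sup>2)"
      using N B dr \<alpha> by (intro frac_le) auto
    then have "r * (norm (1 + of_real \<alpha> * w\<^sup>2) / norm (1 - of_real \<alpha> * w\<^sup>2) *
        (norm v / norm (1 + w - of_real \<alpha> * w\<^sup>2)))
        \<le> r * ((1 + \<alpha> * r\<^sup>2) / (1 - \<alpha> * r\<^sup>2) * (1 / m_poly \<alpha> r))"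
      using V r dr \<alpha> by (intro mult_left_mono mult_mono) auto
    then show ?thesis
      by (simp add: norm_mult norm_divide r_def mult_ac)
  qed
  moreover have "Re (1 + booth \<alpha> w + ?T) \<ge> 1 - norm (booth \<alpha> w) - norm ?T"
    using abs_Re_le_cmod[of "booth \<alpha> w"] abs_Re_le_cmod[of ?T] unfolding plus_complex.sel one_complex.sel
    by linarith
  moreover have "1 - r / (1 - \<alpha> * r\<^sup>2) - r * (1 + \<alpha> * r\<^sup>2) / ((1 - \<alpha> * r\<^sup>2) * m_poly \<alpha> r) =
    l_poly \<alpha> r / ((1 - \<alpha> * r\<^sup>2) * m_poly \<alpha> r)"
    using m dr by (intro l_poly_quotient) (auto simp: r_def)
  ultimately show "l_poly \<alpha> (norm z) / ((1 - \<alpha> * (norm z)\<^sup>2) * m_poly \<alpha> (norm z)) \<le>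
      Re (1 + booth \<alpha> w + ?T)"
    by (simp only: r_def)
qed

lemma class_BS_convex:
  assumes \<alpha>: "0 \<le> \<alpha>" "\<alpha> \<le> 1" and f: "f \<in> class_BS \<alpha>" and z: "norm z < 1"
    and m: "0 < m_poly \<alpha> (norm z)" and l: "0 < l_poly \<alpha> (norm z)"
  shows "deriv f z \<noteq> 0" and "0 < Re (1 + z * deriv (deriv f) z / deriv f z)"
proof -
  have fA: "f \<in> class_A" using f by (simp add: class_BS_def)
  obtain \<omega> where \<omega>: "\<omega> holomorphic_on unit_disc" "\<omega> ` unit_disc \<subseteq> unit_disc" "\<omega> 0 = 0"
    and sub: "\<And>z. norm z < 1 \<Longrightarrow> log_deriv_quot f z - 1 = booth \<alpha> (\<omega> z)"
    using f by (force simp: class_BS_def subordinate_def)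
  have "deriv f z \<noteq> 0 \<and> 0 < Re (1 + z * deriv (deriv f) z / deriv f z)"
  \<comment> \<open>The identity for the quotient covers only z \<noteq> 0; at the origin the
    expression is 1.\<close>
  proof (cases "z = 0")
    case True
    then show ?thesis using fA by (simp add: class_A_def)
  next
    case False
    have eq: "\<forall>z\<in>unit_disc. log_deriv_quot f z = 1 + booth \<alpha> (\<omega> z)"
      using sub by (simp add: diff_eq_eq add.commute)
    have w: "norm (\<omega> z) \<le> norm z"
      using Schwarz_Lemma(1)[OF \<omega>(1,3)] \<omega>(2) z by (auto simp: image_subset_iff)
    note bound = BS_convexity_bound[OF \<alpha> w z Schwarz_Pick[OF \<omega>(1,2) z] m]
    note quot = BS_convexity_quotient_eq[OF \<alpha> fA \<omega>(1,2) eq z False bound(1)]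
    have "0 < l_poly \<alpha> (norm z) / ((1 - \<alpha> * (norm z)\<^sup>2) * m_poly \<alpha> (norm z))"
      using l m booth_denom_pos[OF \<alpha>, of "norm z"] z by simp
    then show ?thesis
      using quot(1) bound(2) unfolding quot(2) by linarith
  qed
  then show "deriv f z \<noteq> 0" and "0 < Re (1 + z * deriv (deriv f) z / deriv f z)" by auto
qed

section \<open>The extremal function\<close>

text \<open>The choice \<omega>(z) = z leads to the equation z f'/f = 1 + z/(1 - \<alpha> z^2), that
  is, (log(f/z))' = 1/(1 - \<alpha> z^2), which is solved by exponentiating a primitive.\<close>

lemma class_BS_extremal:
  assumes \<alpha>: "0 \<le> \<alpha>" "\<alpha> \<le> 1"
  obtains f where "f \<in> class_BS \<alpha>"
    "\<And>z. norm z < 1 \<Longrightarrow> log_deriv_quot f z = 1 + booth \<alpha> z"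
proof -
  have "(\<lambda>z. 1 / (1 - of_real \<alpha> * z\<^sup>2)) holomorphic_on unit_disc"
    using booth_denom_nonzero[OF \<alpha>] by (intro holomorphic_intros) auto
  then obtain h where "\<And>x. x \<in> unit_disc \<Longrightarrow>
      (h has_field_derivative 1 / (1 - of_real \<alpha> * x\<^sup>2)) (at x within unit_disc)"
    using holomorphic_convex_primitive' by (metis convex_ball open_ball)
  then have h: "(h has_field_derivative 1 / (1 - of_real \<alpha> * x\<^sup>2)) (at x)" if "norm x < 1" for x
    using that by (metis at_within_open mem_ball_0 open_ball)
  \<comment> \<open>Subtracting \<open>h 0\<close> normalises the derivative at 0 to 1.\<close>
  define f where "f = (\<lambda>z. z * exp (h z - h 0))"
  have f': "(f has_field_derivative exp (h z - h 0) * (1 + booth \<alpha> z)) (at z)" if "norm z < 1" for z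
    unfolding f_def
    by (rule derivative_eq_intros h that refl)+ (simp add: booth_def algebra_simps)
  then have df: "deriv f z = exp (h z - h 0) * (1 + booth \<alpha> z)" if "norm z < 1" for z
    using that by (metis DERIV_imp_deriv)
  have "f holomorphic_on unit_disc"
    using f' by (force simp: holomorphic_on_open)
  then have fA: "f \<in> class_A"
    by (simp add: class_A_def df) (simp add: f_def booth_def)
  have eq: "log_deriv_quot f z = 1 + booth \<alpha> z" if "norm z < 1" for z
    using that by (cases "z = 0") (simp_all add: log_deriv_quot_def df, simp_all add: f_def booth_def)
  have "(\<lambda>z. log_deriv_quot f z - 1) holomorphic_on unit_disc"
    by (rule holomorphic_transform[OF booth_holomorphic[OF \<alpha>]]) (simp add: eq)
  then have "subordinate (\<lambda>z. log_deriv_quot f z - 1) (booth \<alpha>)"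
    unfolding subordinate_def using booth_holomorphic[OF \<alpha>]
    by (auto intro!: exI[of _ "\<lambda>z. z"] simp: eq)
  then show thesis
    using fA eq that by (simp add: class_BS_def)
qed

text \<open>At z = -r the terms have the signs that the triangle inequality allows for at worst: 1 +
  z - \<alpha> z^2 becomes \<open>m_poly \<alpha> r\<close>, and z and the Booth term are
  negative.\<close>

lemma class_BS_extremal_value:
  assumes \<alpha>: "0 \<le> \<alpha>" "\<alpha> \<le> 1" and r: "0 < r" "r < 1" and m: "m_poly \<alpha> r \<noteq> 0"
  obtains f where "f \<in> class_BS \<alpha>"
    "1 + of_real (- r) * deriv (deriv f) (of_real (- r)) / deriv f (of_real (- r)) =
      of_real (l_poly \<alpha> r / ((1 - \<alpha> * r\<^sup>2) * m_poly \<alpha> r))"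
proof -
  obtain f where f: "f \<in> class_BS \<alpha>"
    "\<And>z. norm z < 1 \<Longrightarrow> log_deriv_quot f z = 1 + booth \<alpha> z"
    using class_BS_extremal[OF \<alpha>] by blast
  define z where "z = complex_of_real (- r)"
  have z: "norm z < 1" "z \<noteq> 0" using r by (auto simp: z_def)
  have d: "1 + z - of_real \<alpha> * z\<^sup>2 = of_real (m_poly \<alpha> r)" by (simp add: z_def m_poly_def)
  then have nz: "1 + z - of_real \<alpha> * z\<^sup>2 \<noteq> 0" using m by simp
  have fA: "f \<in> class_A" using f(1) by (simp add: class_BS_def)
  have "1 + z * deriv (deriv f) z / deriv f z = 1 + booth \<alpha> z +
      z * deriv (\<lambda>z. z) z * (1 + of_real \<alpha> * z\<^sup>2) /
        ((1 - of_real \<alpha> * z\<^sup>2) * (1 + z - of_real \<alpha> * z\<^sup>2))"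
    using BS_convexity_quotient_eq(2)[of \<alpha> f "\<lambda>z. z", OF \<alpha> fA _ _ _ z nz] f(2)
    by simp
  also have "\<dots> = of_real (1 - r / (1 - \<alpha> * r\<^sup>2) - r * (1 + \<alpha> * r\<^sup>2) / ((1 - \<alpha> * r\<^sup>2) * m_poly \<alpha> r))"
    unfolding d by (simp add: z_def booth_def)
  also have "\<dots> = of_real (l_poly \<alpha> r / ((1 - \<alpha> * r\<^sup>2) * m_poly \<alpha> r))"
    using l_poly_quotient[of \<alpha> r] m booth_denom_pos[OF \<alpha>, of r] r by simp
  finally show thesis
    using that[OF f(1)] by (simp add: z_def)
qed

section \<open>The radius of convexity and its sharpness\<close>

theorem theorem3p1:
  fixes \<alpha> :: real
  assumes "0 \<le> \<alpha>" and "\<alpha> \<le> 1"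
  shows "\<exists>r' r''.
           {r \<in> {0<..1}. l_poly \<alpha> r = 0} = {r'} \<and>
           {r \<in> {0<..1}. m_poly \<alpha> r = 0} = {r''} \<and>
           is_radius_of_convexity (class_BS \<alpha>) (min r' r'')"
proof -
  obtain a b where ab: "{r \<in> {0<..1}. l_poly \<alpha> r = 0} = {a}"
    "{r \<in> {0<..1}. m_poly \<alpha> r = 0} = {b}" "a < b"
    by (rule poly_roots[OF assms])
  have a: "0 < a" "l_poly \<alpha> a = 0" and b: "b \<le> 1" "m_poly \<alpha> b = 0"
    using ab(1,2) by auto
  have m_pos: "0 < m_poly \<alpha> r" if "0 \<le> r" "r \<le> a" for r
    using m_poly_strict_antimono[of \<alpha> r b] assms that ab(3) b by simp
  \<comment> \<open>Since a < b, the minimum of the two roots is a.\<close>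
  have "is_radius_of_convexity (class_BS \<alpha>) a"
    unfolding is_radius_of_convexity_def
  proof (intro conjI ballI impI)
    show "a \<in> {0..1}" using a b ab(3) by auto
    show "convex_within (class_BS \<alpha>) a"
      unfolding convex_within_def
    proof (intro ballI allI impI conjI)
      fix f and z :: complex assume f: "f \<in> class_BS \<alpha>" and z: "norm z < a"
      have "0 < l_poly \<alpha> (norm z)"
        using l_poly_strict_antimono[of \<alpha> "norm z" a] m_pos[of a] assms z a by simp
      then show "deriv f z \<noteq> 0" "0 < Re (1 + z * deriv (deriv f) z / deriv f z)"
        using class_BS_convex[OF assms f] m_pos[of "norm z"] z ab(3) b by auto
    qed
    show "s \<le> a" if "s \<in> {0..1}" and s: "convex_within (class_BS \<alpha>) s" for s
    proof (rule ccontr)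
      assume "\<not> s \<le> a"
      \<comment> \<open>If s exceeded a, the point -a would lie in |z| < s. It also lies in the unit
        disc, as a < b \<le> 1, and there the extremal function gives the value 0, contradicting
        strict positivity.\<close>
      have "a < 1" "m_poly \<alpha> a \<noteq> 0" using a b ab(3) m_pos[of a] by auto
      obtain f where "f \<in> class_BS \<alpha>"
        "1 + of_real (- a) * deriv (deriv f) (of_real (- a)) / deriv f (of_real (- a)) =
          of_real (l_poly \<alpha> a / ((1 - \<alpha> * a\<^sup>2) * m_poly \<alpha> a))"
        by (rule class_BS_extremal_value[OF assms a(1) \<open>a < 1\<close> \<open>m_poly \<alpha> a \<noteq> 0\<close>])
      moreover have "norm (complex_of_real (- a)) < s"
        using \<open>\<not> s \<le> a\<close> a by simp
      ultimately have "0 < Re (of_real (l_poly \<alpha> a / ((1 - \<alpha> * a\<^sup>2) * m_poly \<alpha> a)))"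
        using s unfolding convex_within_def by metis
      then show False using a by simp
    qed
  qed
  then show ?thesis
    using ab by (intro exI[of _ a] exI[of _ b]) simp
qed

end
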